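(* If $X$ is a coverable uniform space then $\widetilde{X}$ is universal.
   Context: All entourages are taken to be symmetric. Each space has a fixed basepoint $*$. For an entourage $E$ of a uniform space $X$, an $E$-chain from $p$ to $q$ is a finite sequence $\{x_0=p,\dots,x_n=q\}$ with $(x_i,x_{i+1})\in E$ for all $i$. Two $E$-chains with the same endpoints are $E$-homotopic if one is obtained from the other in finitely many steps, each adding or removing a single point, always keeping the endpoints fixed and keeping an $E$-chain at each stage (in particular $\{p\}$ and $\{p,p\}$ are $E$-homotopic); $[\alpha]_E$ is the class of $\alpha$. $X_E$ is the set of $E$-homotopy classes of $E$-chains starting at $*$, with basepoint $[*]_E$. For an entourage $D\subset E$ let $D^*$ be the set of pairs $([*=x_0,\dots,x_n,y]_E,[*=x_0,\dots,x_n,z]_E)$ with $(y,z)\in D$; $X_E$ carries the uniformity with base $\{D^*:D\subset E\}$. The endpoint map is $\phi_{XE}:X_E\to X$, and for $D\subset E$, $\phi_{ED}:X_D\to X_E$ is $[\alpha]_D\mapsto[\alpha]_E$. $\widetilde{X}=\varprojlim X_E$ (over all entourages, ordered by reverse inclusion, with the inverse limit uniformity and basepoint $([*]_E)_E$), with projections $\phi_E:\widetilde{X}\to X_E$. $X$ is coverable if its uniformity has a base, containing $X\times X$, of entourages $E$ for which $\phi_E$ is surjective. A uniform space $X$ is universal if its uniformity has a base $\mathcal{U}$ such that for every $E\in\mathcal{U}$ the map $\phi_{XE}:X_E\to X$ is a uniform homeomorphism. *)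

theory Defs
  imports "HOL-Library.FuncSet" Complex_Main
begin

(* The type class uniform_space does not apply to spaces whose points depend on an entourage,
   so a uniform structure is placed on a carrier set, as a filter in the style of that class. *)

record 'a pointed_space =
  points :: "'a set"
  unif :: "('a \<times> 'a) filter"
  basepoint :: 'a

definition pointed_uniform_space :: "('a, 'm) pointed_space_scheme \<Rightarrow> bool" where
  "pointed_uniform_space S \<longleftrightarrow>
     basepoint S \<in> points S \<and>
     unif S \<le> principal (points S \<times> points S) \<and>
     (\<forall>P. eventually P (unif S) \<longrightarrow> (\<forall>x\<in>points S. P (x, x))) \<and>
     (\<forall>P. eventually P (unif S) \<longrightarrow> eventually (\<lambda>(x, y). P (y, x)) (unif S)) \<and>
     (\<forall>P. eventually P (unif S) \<longrightarrow>
        (\<exists>Q. eventually Q (unif S) \<and> (\<forall>x y z. Q (x, y) \<longrightarrow> Q (y, z) \<longrightarrow> P (x, z))))"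

lemma pointed_uniform_space_type_class:
  fixes p :: "'a::uniform_space"
  shows "pointed_uniform_space \<lparr>points = UNIV, unif = uniformity, basepoint = p\<rparr>"
  unfolding pointed_uniform_space_def
  using uniformity_refl uniformity_sym uniformity_trans by auto

definition entourages :: "('a, 'm) pointed_space_scheme \<Rightarrow> ('a \<times> 'a) set set" where
  "entourages S =
     {E. E \<subseteq> points S \<times> points S \<and> sym E \<and> eventually (\<lambda>p. p \<in> E) (unif S)}"

definition uniformity_base ::
    "('a, 'm) pointed_space_scheme \<Rightarrow> ('a \<times> 'a) set set \<Rightarrow> bool" where
  "uniformity_base S B \<longleftrightarrow> B \<subseteq> entourages S \<and> (\<forall>D\<in>entourages S. \<exists>E\<in>B. E \<subseteq> D)"

definition unif_continuous ::
    "('a, 'm) pointed_space_scheme \<Rightarrow> ('b, 'n) pointed_space_scheme \<Rightarrow> ('a \<Rightarrow> 'b) \<Rightarrow> bool" where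
  "unif_continuous S T f \<longleftrightarrow>
     f \<in> points S \<rightarrow> points T \<and> filterlim (map_prod f f) (unif T) (unif S)"

definition unif_homeomorphism ::
    "('a, 'm) pointed_space_scheme \<Rightarrow> ('b, 'n) pointed_space_scheme \<Rightarrow> ('a \<Rightarrow> 'b) \<Rightarrow> bool" where
  "unif_homeomorphism S T f \<longleftrightarrow>
     bij_betw f (points S) (points T) \<and>
     unif_continuous S T f \<and> unif_continuous T S (inv_into (points S) f)"

definition is_chain ::
    "('a, 'm) pointed_space_scheme \<Rightarrow> ('a \<times> 'a) set \<Rightarrow> 'a \<Rightarrow> 'a \<Rightarrow> 'a list \<Rightarrow> bool" where
  "is_chain S E p q xs \<longleftrightarrow>
     xs \<noteq> [] \<and> set xs \<subseteq> points S \<and> hd xs = p \<and> last xs = q \<and>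
     successively (\<lambda>x y. (x, y) \<in> E) xs"

definition adds_point ::
    "('a, 'm) pointed_space_scheme \<Rightarrow> ('a \<times> 'a) set \<Rightarrow> 'a list \<Rightarrow> 'a list \<Rightarrow> bool" where
  "adds_point S E \<alpha> \<beta> \<longleftrightarrow>
     (\<exists>p q. is_chain S E p q \<alpha> \<and> is_chain S E p q \<beta>) \<and>
     (\<exists>xs x ys. \<alpha> = xs @ ys \<and> \<beta> = xs @ [x] @ ys)"

definition chain_homotopic ::
    "('a, 'm) pointed_space_scheme \<Rightarrow> ('a \<times> 'a) set \<Rightarrow> 'a list \<Rightarrow> 'a list \<Rightarrow> bool" where
  "chain_homotopic S E = equivclp (adds_point S E)"

definition chain_class ::
    "('a, 'm) pointed_space_scheme \<Rightarrow> ('a \<times> 'a) set \<Rightarrow> 'a list \<Rightarrow> 'a list set" where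
  "chain_class S E \<alpha> = {\<beta>. chain_homotopic S E \<alpha> \<beta>}"

definition star_entourage ::
    "('a, 'm) pointed_space_scheme \<Rightarrow> ('a \<times> 'a) set \<Rightarrow> ('a \<times> 'a) set
      \<Rightarrow> ('a list set \<times> 'a list set) set" where
  "star_entourage S E D =
     {(chain_class S E (xs @ [y]), chain_class S E (xs @ [z])) | xs y z.
        xs \<noteq> [] \<and> is_chain S E (basepoint S) y (xs @ [y]) \<and>
        is_chain S E (basepoint S) z (xs @ [z]) \<and> (y, z) \<in> D}"

(* The sets D* form a filter base (see eventually_unif_chain_space), so the infimum of the
   principal filters is the uniformity with base the sets D*. *)

definition chain_space ::
    "('a, 'm) pointed_space_scheme \<Rightarrow> ('a \<times> 'a) set \<Rightarrow> 'a list set pointed_space" where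
  "chain_space S E =
     \<lparr>points = {chain_class S E \<alpha> | \<alpha> q. is_chain S E (basepoint S) q \<alpha>},
      unif = (INF D \<in> {D \<in> entourages S. D \<subseteq> E}. principal (star_entourage S E D)),
      basepoint = chain_class S E [basepoint S]\<rparr>"

(* The next two maps send a class to the common value of a function on its representatives;
   see endpoint_chain_class and coarsen_chain_class. *)

definition endpoint :: "'a list set \<Rightarrow> 'a" where
  "endpoint c = the_elem (last ` c)"

definition coarsen ::
    "('a, 'm) pointed_space_scheme \<Rightarrow> ('a \<times> 'a) set \<Rightarrow> 'a list set \<Rightarrow> 'a list set" where
  "coarsen S E c = the_elem (chain_class S E ` c)"

(* A point of the inverse limit is a family indexed by the entourages (extended by undefined);
   the uniformity is the coarsest one making all projections uniformly continuous. *)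

definition inverse_limit ::
    "('a, 'm) pointed_space_scheme \<Rightarrow> (('a \<times> 'a) set \<Rightarrow> 'a list set) pointed_space" where
  "inverse_limit S =
     (let L = {x \<in> (\<Pi>\<^sub>E E\<in>entourages S. points (chain_space S E)).
                 \<forall>D\<in>entourages S. \<forall>E\<in>entourages S. D \<subseteq> E \<longrightarrow> coarsen S E (x D) = x E}
      in \<lparr>points = L,
          unif = inf (principal (L \<times> L))
            (INF E \<in> entourages S.
               filtercomap (map_prod (\<lambda>x. x E) (\<lambda>x. x E)) (unif (chain_space S E))),
          basepoint = (\<lambda>E\<in>entourages S. basepoint (chain_space S E))\<rparr>)"

definition coverable :: "('a, 'm) pointed_space_scheme \<Rightarrow> bool" where
  "coverable S \<longleftrightarrow>
     pointed_uniform_space S \<and>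
     (\<exists>B. uniformity_base S B \<and> points S \<times> points S \<in> B \<and>
        (\<forall>E\<in>B. (\<lambda>x. x E) ` points (inverse_limit S) = points (chain_space S E)))"

definition universal :: "('a, 'm) pointed_space_scheme \<Rightarrow> bool" where
  "universal S \<longleftrightarrow>
     pointed_uniform_space S \<and>
     (\<exists>B. uniformity_base S B \<and>
        (\<forall>E\<in>B. unif_homeomorphism (chain_space S E) S endpoint))"


lemma adds_point_same_ends:
  assumes "adds_point S E \<alpha> \<beta>"
  shows "is_chain S E p q \<alpha> \<longleftrightarrow> is_chain S E p q \<beta>"
  using assms by (auto simp: adds_point_def is_chain_def)

lemma chain_homotopic_same_ends:
  assumes "chain_homotopic S E \<alpha> \<beta>"
  shows "is_chain S E p q \<alpha> \<longleftrightarrow> is_chain S E p q \<beta>"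
  using assms unfolding chain_homotopic_def
  by (induction rule: equivclp_induct) (auto dest: adds_point_same_ends)

lemma chain_class_eq_iff:
  "chain_class S E \<alpha> = chain_class S E \<beta> \<longleftrightarrow> chain_homotopic S E \<alpha> \<beta>"
  unfolding chain_class_def chain_homotopic_def
  by (auto intro: equivclp_trans equivclp_sym)

lemma chain_homotopic_mono:
  assumes "chain_homotopic S D \<alpha> \<beta>" "D \<subseteq> E"
  shows "chain_homotopic S E \<alpha> \<beta>"
proof -
  have "adds_point S E a b" if "adds_point S D a b" for a b
    using that \<open>D \<subseteq> E\<close> unfolding adds_point_def is_chain_def
    by (fastforce elim: successively_mono)
  then have "symclp (adds_point S D) \<le> symclp (adds_point S E)"
    by (auto simp: symclp_def)
  then show ?thesis
    using assms(1) rtranclp_mono unfolding chain_homotopic_def equivclp_def by blast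
qed

lemma endpoint_chain_class:
  assumes "is_chain S E p q \<alpha>"
  shows "endpoint (chain_class S E \<alpha>) = q"
proof -
  have "\<alpha> \<in> chain_class S E \<alpha>" "last \<beta> = q" if "\<beta> \<in> chain_class S E \<alpha>" for \<beta>
    using that assms chain_homotopic_same_ends[of S E \<alpha> \<beta> p q]
    by (auto simp: chain_class_def chain_homotopic_def is_chain_def)
  moreover have "\<alpha> \<in> chain_class S E \<alpha>"
    by (simp add: chain_class_def chain_homotopic_def)
  ultimately have "last ` chain_class S E \<alpha> = {q}"
    by blast
  then show ?thesis by (simp add: endpoint_def)
qed

lemma coarsen_chain_class:
  assumes "D \<subseteq> E"
  shows "coarsen S E (chain_class S D \<alpha>) = chain_class S E \<alpha>"
proof -
  have "chain_class S E \<beta> = chain_class S E \<alpha>" if "\<beta> \<in> chain_class S D \<alpha>" for \<beta>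
  proof -
    from that have "chain_homotopic S E \<alpha> \<beta>"
      using assms by (auto simp: chain_class_def intro: chain_homotopic_mono)
    then show ?thesis by (metis chain_class_eq_iff)
  qed
  moreover have "\<alpha> \<in> chain_class S D \<alpha>"
    by (simp add: chain_class_def chain_homotopic_def)
  ultimately have "chain_class S E ` chain_class S D \<alpha> = {chain_class S E \<alpha>}"
    by blast
  then show ?thesis by (simp add: coarsen_def)
qed

lemma entourages_Int:
  assumes "D \<in> entourages S" "E \<in> entourages S"
  shows "D \<inter> E \<in> entourages S"
  using assms by (auto simp: entourages_def intro: sym_Int eventually_conj)

lemma eventually_unif_chain_space:
  assumes "E \<in> entourages S"
  shows "eventually P (unif (chain_space S E)) \<longleftrightarrow>
    (\<exists>D\<in>entourages S. D \<subseteq> E \<and> (\<forall>c\<in>star_entourage S E D. P c))"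
proof -
  have "eventually P (unif (chain_space S E)) \<longleftrightarrow>
    (\<exists>D\<in>{D \<in> entourages S. D \<subseteq> E}. eventually P (principal (star_entourage S E D)))"
    unfolding chain_space_def pointed_space.simps
  proof (rule eventually_INF_base)
    show "{D \<in> entourages S. D \<subseteq> E} \<noteq> {}" using assms by auto
  next
    fix D D' assume "D \<in> {D \<in> entourages S. D \<subseteq> E}" "D' \<in> {D \<in> entourages S. D \<subseteq> E}"
    moreover have "star_entourage S E (D \<inter> D') \<subseteq> star_entourage S E D \<inter> star_entourage S E D'"
      unfolding star_entourage_def by blast
    ultimately show "\<exists>F\<in>{D \<in> entourages S. D \<subseteq> E}. principal (star_entourage S E F)
        \<le> inf (principal (star_entourage S E D)) (principal (star_entourage S E D'))"
      by (intro bexI[of _ "D \<inter> D'"]) (auto intro: entourages_Int)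
  qed
  then show ?thesis by (auto simp: eventually_principal)
qed

end

theory Submission
  imports Defs
begin

text \<open>Write \<open>Y\<close> for the inverse limit of the spaces \<open>X_E\<close>. The proof rests on two
  facts about chains.

  First, \<open>X_E\<close> is its own universal cover at the scale \<open>E*\<close>: every \<open>E*\<close>-chain from the
  basepoint is the sequence of classes of the prefixes of its projection to \<open>X\<close>. This is unique
  path lifting. It lifts homotopies too, since inserting a point into an \<open>E\<close>-chain only inserts
  one class into the sequence of prefix classes. Two \<open>E*\<close>-chains that end at the same class
  have \<open>E\<close>-homotopic projections, by the meaning of that class, and are therefore
  \<open>E*\<close>-homotopic (\<open>simply_chained_chain_space\<close>).

  Secondly, this property pulls back along every surjection \<open>f\<close> if the entourage upstairs is the
  full preimage of the one downstairs: points in one fibre of \<open>f\<close> cannot be told apart by the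
  preimage, so chains and homotopies can be lifted point by point
  (\<open>simply_chained_pullback\<close>).

  Coverability makes the projections \<open>Y \<rightarrow> X_E\<close> surjective for all \<open>E\<close> in a base \<open>B\<close>. The
  preimages in \<open>Y\<close> of the entourages \<open>E*\<close> with \<open>E \<in> B\<close> form a base of the uniformity of \<open>Y\<close>
  (\<open>uniformity_base_limit_entourages\<close>), and for each of them the endpoint map is bijective by the
  two facts above. A bijective endpoint map is a uniform homeomorphism
  (\<open>unif_homeomorphism_endpoint\<close>).\<close>

section \<open>Chain homotopies\<close>

lemma chain_homotopic_refl: "chain_homotopic S E \<alpha> \<alpha>"
  by (simp add: chain_homotopic_def)

lemma chain_homotopic_sym: "chain_homotopic S E \<alpha> \<beta> \<Longrightarrow> chain_homotopic S E \<beta> \<alpha>"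
  unfolding chain_homotopic_def by (rule equivclp_sym)

lemma chain_homotopic_trans [trans]:
  "chain_homotopic S E \<alpha> \<beta> \<Longrightarrow> chain_homotopic S E \<beta> \<gamma> \<Longrightarrow> chain_homotopic S E \<alpha> \<gamma>"
  unfolding chain_homotopic_def by (rule equivclp_trans)

lemma chain_homotopic_insert:
  assumes "is_chain S E p q (xs @ ys)" "is_chain S E p q (xs @ x # ys)"
  shows "chain_homotopic S E (xs @ ys) (xs @ x # ys)"
proof -
  have "adds_point S E (xs @ ys) (xs @ x # ys)"
    unfolding adds_point_def using assms by force
  then show ?thesis by (auto simp: chain_homotopic_def)
qed

text \<open>Invariance of a construction on chains has to be checked for single insertions only. The end
  points are carried along because the constructions below yield chains only when applied to
  chains with prescribed ends.\<close>

lemma chain_homotopic_image: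
  assumes "chain_homotopic S E \<alpha> \<beta>" "is_chain S E p q \<alpha>"
    and "\<And>a b. adds_point S E a b \<Longrightarrow> is_chain S E p q a \<Longrightarrow> is_chain S E p q b
      \<Longrightarrow> chain_homotopic T F (f a) (f b)"
  shows "chain_homotopic T F (f \<alpha>) (f \<beta>)"
  using assms(1) unfolding chain_homotopic_def
proof (induction rule: equivclp_induct)
  case base
  then show ?case by simp
next
  case (step y z)
  have y: "is_chain S E p q y"
    using step(1) assms(2) chain_homotopic_same_ends[of S E \<alpha> y p q]
    by (simp add: chain_homotopic_def)
  with step(2) have z: "is_chain S E p q z"
    by (metis adds_point_same_ends)
  from step(2) have "chain_homotopic T F (f y) (f z)"
    using assms(3) y z chain_homotopic_sym by blast
  with step(3) show ?case
    unfolding chain_homotopic_def by (rule equivclp_trans)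
qed

lemma is_chain_snoc:
  assumes "is_chain S E p q \<alpha>" "(q, z) \<in> E" "z \<in> points S"
  shows "is_chain S E p z (\<alpha> @ [z])"
  using assms by (auto simp: is_chain_def successively_append_iff)

lemma chain_homotopic_snoc:
  assumes "chain_homotopic S E \<alpha> \<beta>" "is_chain S E p q \<alpha>" "(q, z) \<in> E" "z \<in> points S"
  shows "chain_homotopic S E (\<alpha> @ [z]) (\<beta> @ [z])"
  using assms(1,2)
proof (rule chain_homotopic_image[where f = "\<lambda>\<alpha>. \<alpha> @ [z]"])
  fix a b assume "adds_point S E a b" "is_chain S E p q a" "is_chain S E p q b"
  then have ch: "is_chain S E p z (a @ [z])" "is_chain S E p z (b @ [z])"
    and "\<exists>xs x ys. a = xs @ ys \<and> b = xs @ x # ys"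
    using is_chain_snoc[OF _ assms(3,4)] by (auto simp: adds_point_def)
  then obtain xs x ys where eq: "a = xs @ ys" "b = xs @ x # ys" by blast
  show "chain_homotopic S E (a @ [z]) (b @ [z])"
    using chain_homotopic_insert[of S E p z xs "ys @ [z]" x] ch eq by simp
qed

lemma chain_homotopic_shortcut:
  assumes "is_chain S E p q \<alpha>" "(q, y) \<in> E" "(y, z) \<in> E" "(q, z) \<in> E"
    "y \<in> points S" "z \<in> points S"
  shows "chain_homotopic S E (\<alpha> @ [z]) (\<alpha> @ [y, z])"
  using chain_homotopic_insert[of S E p z \<alpha> "[z]" y]
    is_chain_snoc[OF assms(1,4,6)] is_chain_snoc[OF is_chain_snoc[OF assms(1,2,5)] assms(3,6)]
  by simp

section \<open>Entourages and their lifts to the chain spaces\<close>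

lemma entourages_refl:
  assumes "pointed_uniform_space S" "E \<in> entourages S" "x \<in> points S"
  shows "(x, x) \<in> E"
  using assms by (auto simp: pointed_uniform_space_def entourages_def)

lemma entourages_points: "E \<in> entourages S \<Longrightarrow> (x, y) \<in> E \<Longrightarrow> x \<in> points S \<and> y \<in> points S"
  by (auto simp: entourages_def)

lemma entourages_UNIV:
  assumes "pointed_uniform_space S"
  shows "points S \<times> points S \<in> entourages S"
  using assms
  by (auto simp: pointed_uniform_space_def entourages_def le_principal intro: symI)

lemma entourage_within:
  assumes "pointed_uniform_space S" "eventually P (unif S)"
  shows "\<exists>D\<in>entourages S. \<forall>p\<in>D. P p"
proof
  let ?D = "{(x, y) \<in> points S \<times> points S. P (x, y) \<and> P (y, x)}"
  have "eventually (\<lambda>p. p \<in> points S \<times> points S) (unif S)"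
    "eventually (\<lambda>(x, y). P (y, x)) (unif S)"
    using assms by (auto simp: pointed_uniform_space_def le_principal)
  then have "eventually (\<lambda>p. p \<in> ?D) (unif S)"
    using assms(2) by eventually_elim auto
  then show "?D \<in> entourages S"
    by (auto simp: entourages_def intro: symI)
  show "\<forall>p\<in>?D. P p" by auto
qed

lemma entourages_half:
  assumes "pointed_uniform_space S" "E \<in> entourages S"
  shows "\<exists>D\<in>entourages S. D \<subseteq> E \<and> (\<forall>x y z. (x, y) \<in> D \<longrightarrow> (y, z) \<in> D \<longrightarrow> (x, z) \<in> E)"
proof -
  obtain Q where Q: "eventually Q (unif S)" "\<And>x y z. Q (x, y) \<Longrightarrow> Q (y, z) \<Longrightarrow> (x, z) \<in> E"
    using assms by (force simp: pointed_uniform_space_def entourages_def)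
  obtain D where D: "D \<in> entourages S" "\<forall>p\<in>D. Q p"
    using entourage_within[OF assms(1) Q(1)] by blast
  show ?thesis
    using entourages_Int[OF D(1) assms(2)] D(2) Q(2)
    by (intro bexI[of _ "D \<inter> E"]) blast+
qed

lemma chain_class_in_points:
  "is_chain S E (basepoint S) q \<alpha> \<Longrightarrow> chain_class S E \<alpha> \<in> points (chain_space S E)"
  by (auto simp: chain_space_def)

lemma chain_space_pointE:
  assumes "c \<in> points (chain_space S E)"
  obtains \<alpha> q where "c = chain_class S E \<alpha>" "is_chain S E (basepoint S) q \<alpha>"
  using assms by (auto simp: chain_space_def)

lemma is_chain_singleton: "p \<in> points S \<Longrightarrow> is_chain S E p p [p]"
  by (simp add: is_chain_def)

text \<open>The definition of \<open>D*\<close> lets a common initial segment be followed by two last points. Since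
  \<open>D\<close> lies in \<open>E\<close>, the second class is then a one-step extension of the first one, and this holds
  for every representative of the first class. All later arguments use this form, because
  representatives can be extended step by step.\<close>

lemma star_entourage_iff:
  assumes S: "pointed_uniform_space S" and E: "E \<in> entourages S" and D: "D \<in> entourages S" "D \<subseteq> E"
    and \<alpha>: "is_chain S E (basepoint S) y \<alpha>"
  shows "(chain_class S E \<alpha>, d) \<in> star_entourage S E D
    \<longleftrightarrow> (\<exists>z. (y, z) \<in> D \<and> d = chain_class S E (\<alpha> @ [z]))"
proof
  assume "(chain_class S E \<alpha>, d) \<in> star_entourage S E D"
  then obtain xs y' z where xs: "xs \<noteq> []" "is_chain S E (basepoint S) y' (xs @ [y'])"
      "is_chain S E (basepoint S) z (xs @ [z])" "(y', z) \<in> D"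
    and eq: "chain_class S E \<alpha> = chain_class S E (xs @ [y'])" "d = chain_class S E (xs @ [z])"
    by (auto simp: star_entourage_def)
  have [simp]: "y' = y"
    using endpoint_chain_class[OF \<alpha>] endpoint_chain_class[OF xs(2)] eq(1) by simp
  have z: "z \<in> points S" "(y, z) \<in> E"
    using entourages_points[OF D(1) xs(4)] xs(4) D(2) by auto
  have "chain_homotopic S E (xs @ [z]) ((xs @ [y]) @ [z])"
    using chain_homotopic_insert[of S E "basepoint S" z xs "[z]" y] xs(3)
      is_chain_snoc[OF xs(2), of z] z by simp
  also have "chain_homotopic S E ((xs @ [y]) @ [z]) (\<alpha> @ [z])"
    using chain_homotopic_snoc[OF _ xs(2), of \<alpha> z] z eq(1)
    by (simp add: chain_class_eq_iff chain_homotopic_sym)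
  finally have "d = chain_class S E (\<alpha> @ [z])"
    by (simp add: eq(2) chain_class_eq_iff)
  with xs(4) show "\<exists>z. (y, z) \<in> D \<and> d = chain_class S E (\<alpha> @ [z])" by auto
next
  assume "\<exists>z. (y, z) \<in> D \<and> d = chain_class S E (\<alpha> @ [z])"
  then obtain z where z: "(y, z) \<in> D" "d = chain_class S E (\<alpha> @ [z])" by blast
  have yz: "y \<in> points S" "z \<in> points S" "(y, y) \<in> E" "(y, z) \<in> E"
    using entourages_points[OF D(1) z(1)] entourages_refl[OF S E] z(1) D(2) by auto
  have ch: "is_chain S E (basepoint S) y (\<alpha> @ [y])" "is_chain S E (basepoint S) z (\<alpha> @ [z])"
    using is_chain_snoc[OF \<alpha>] yz by auto
  have "chain_homotopic S E (\<alpha> @ []) (\<alpha> @ [y])"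
    by (rule chain_homotopic_insert) (use \<alpha> ch in auto)
  then have "chain_class S E \<alpha> = chain_class S E (\<alpha> @ [y])"
    by (simp add: chain_class_eq_iff)
  then show "(chain_class S E \<alpha>, d) \<in> star_entourage S E D"
    unfolding star_entourage_def using z ch \<alpha>
    by (fastforce simp: is_chain_def)
qed

lemma star_entourageE:
  assumes "pointed_uniform_space S" "E \<in> entourages S" "D \<in> entourages S" "D \<subseteq> E"
    and "(c, d) \<in> star_entourage S E D"
  obtains \<alpha> y z where "is_chain S E (basepoint S) y \<alpha>" "(y, z) \<in> D"
    "c = chain_class S E \<alpha>" "d = chain_class S E (\<alpha> @ [z])"
    "is_chain S E (basepoint S) z (\<alpha> @ [z])"
proof -
  obtain \<alpha> y where \<alpha>: "c = chain_class S E \<alpha>" "is_chain S E (basepoint S) y \<alpha>"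
    using assms(5) by (auto simp: star_entourage_def)
  then obtain z where z: "(y, z) \<in> D" "d = chain_class S E (\<alpha> @ [z])"
    using star_entourage_iff[OF assms(1-4) \<alpha>(2)] assms(5) by blast
  moreover have "is_chain S E (basepoint S) z (\<alpha> @ [z])"
    using is_chain_snoc[OF \<alpha>(2)] z(1) assms(4) entourages_points[OF assms(3) z(1)] by auto
  ultimately show ?thesis using \<alpha> that by blast
qed

lemma star_entourage_refl:
  assumes "pointed_uniform_space S" "E \<in> entourages S" "c \<in> points (chain_space S E)"
  shows "(c, c) \<in> star_entourage S E E"
proof -
  obtain \<alpha> q where \<alpha>: "c = chain_class S E \<alpha>" "is_chain S E (basepoint S) q \<alpha>"
    using chain_space_pointE[OF assms(3)] .
  have q: "q \<in> points S"
    using \<alpha>(2) by (auto simp: is_chain_def)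
  have qq: "(q, q) \<in> E"
    using entourages_refl[OF assms(1,2) q] .
  have "chain_homotopic S E (\<alpha> @ []) (\<alpha> @ [q])"
    by (rule chain_homotopic_insert) (use \<alpha>(2) is_chain_snoc[OF \<alpha>(2) qq q] in auto)
  then show ?thesis
    using star_entourage_iff[OF assms(1,2,2) order_refl \<alpha>(2)] qq \<alpha>(1)
    by (auto simp: chain_class_eq_iff)
qed

lemma sym_star_entourage: "sym D \<Longrightarrow> sym (star_entourage S E D)"
  unfolding star_entourage_def by (blast intro: symI dest: symD)

lemma star_entourage_coarsen:
  assumes "(c, d) \<in> star_entourage S D D" "D \<subseteq> E"
  shows "(coarsen S E c, coarsen S E d) \<in> star_entourage S E D"
proof -
  have mono: "is_chain S E p q \<alpha>" if "is_chain S D p q \<alpha>" for p q \<alpha>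
    using that assms(2) by (auto simp: is_chain_def elim: successively_mono)
  show ?thesis
    using assms mono unfolding star_entourage_def by (auto simp: coarsen_chain_class) blast
qed

lemma star_entourage_mono: "D \<subseteq> D' \<Longrightarrow> star_entourage S E D \<subseteq> star_entourage S E D'"
  unfolding star_entourage_def by blast

text \<open>The triangle inequality for the lifted entourages: if \<open>D \<circ> D \<subseteq> E\<close>, then two successive \<open>D\<close>-steps can
  be replaced by a single \<open>E\<close>-step without changing the \<open>E\<close>-homotopy class.\<close>

lemma star_entourage_trans:
  assumes S: "pointed_uniform_space S" and E: "E \<in> entourages S" and D: "D \<in> entourages S" "D \<subseteq> E"
    and half: "\<And>x y z. (x, y) \<in> D \<Longrightarrow> (y, z) \<in> D \<Longrightarrow> (x, z) \<in> E"
    and "(c, d) \<in> star_entourage S E D" "(d, e) \<in> star_entourage S E D"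
  shows "(c, e) \<in> star_entourage S E E"
proof -
  obtain \<alpha> y z where \<alpha>: "is_chain S E (basepoint S) y \<alpha>" "(y, z) \<in> D" "c = chain_class S E \<alpha>"
      "d = chain_class S E (\<alpha> @ [z])" "is_chain S E (basepoint S) z (\<alpha> @ [z])"
    using star_entourageE[OF S E D assms(6)] by metis
  obtain w where w: "(z, w) \<in> D" "e = chain_class S E (\<alpha> @ [z, w])"
    using star_entourage_iff[OF S E D \<alpha>(5)] \<alpha>(4) assms(7) by auto
  have yw: "(y, w) \<in> E" using half[OF \<alpha>(2) w(1)] .
  then have "chain_homotopic S E (\<alpha> @ [w]) (\<alpha> @ [z, w])"
    using chain_homotopic_shortcut[OF \<alpha>(1)] \<alpha>(2) w(1) D entourages_points[OF E] by blast
  then have "e = chain_class S E (\<alpha> @ [w])"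
    using w(2) by (simp add: chain_class_eq_iff chain_homotopic_sym)
  then show ?thesis
    using star_entourage_iff[OF S E E order_refl \<alpha>(1)] yw \<alpha>(3) by blast
qed

section \<open>Entourages with exactly one homotopy class of chains to each point\<close>

definition simply_chained :: "('a, 'm) pointed_space_scheme \<Rightarrow> ('a \<times> 'a) set \<Rightarrow> bool" where
  "simply_chained S E \<longleftrightarrow>
     (\<forall>q\<in>points S. \<exists>\<alpha>. is_chain S E (basepoint S) q \<alpha>) \<and>
     (\<forall>q \<alpha> \<beta>. is_chain S E (basepoint S) q \<alpha> \<longrightarrow> is_chain S E (basepoint S) q \<beta>
        \<longrightarrow> chain_homotopic S E \<alpha> \<beta>)"

text \<open>The property says that the endpoint map is a bijection. Its inverse extends a chain by
  one step whenever the endpoint moves within \<open>D \<subseteq> E\<close>, so that it carries \<open>D\<close> into \<open>D*\<close>: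
  uniform continuity in both directions comes for free.\<close>

lemma unif_homeomorphism_endpoint:
  assumes S: "pointed_uniform_space S" and E: "E \<in> entourages S" and sc: "simply_chained S E"
  shows "unif_homeomorphism (chain_space S E) S endpoint"
proof -
  let ?C = "chain_space S E"
  have bij: "bij_betw endpoint (points ?C) (points S)"
  proof (rule bij_betwI')
    fix c d assume "c \<in> points ?C" "d \<in> points ?C"
    then show "endpoint c = endpoint d \<longleftrightarrow> c = d"
      using sc unfolding simply_chained_def
      by (metis chain_space_pointE endpoint_chain_class chain_class_eq_iff)
  next
    fix c assume "c \<in> points ?C"
    then show "endpoint c \<in> points S"
      by (elim chain_space_pointE) (auto simp: endpoint_chain_class is_chain_def)
  next
    fix q assume "q \<in> points S"
    then obtain \<alpha> where "is_chain S E (basepoint S) q \<alpha>"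
      using sc by (auto simp: simply_chained_def)
    then show "\<exists>c\<in>points ?C. q = endpoint c"
      by (metis chain_class_in_points endpoint_chain_class)
  qed
  have inv: "inv_into (points ?C) endpoint q = chain_class S E \<alpha>"
    if "is_chain S E (basepoint S) q \<alpha>" for q \<alpha>
    using inv_into_f_f[OF bij_betw_imp_inj_on[OF bij] chain_class_in_points[OF that]]
    by (simp add: endpoint_chain_class[OF that])
  have "filterlim (map_prod endpoint endpoint) (unif S) (unif ?C)"
    unfolding filterlim_iff
  proof (intro allI impI)
    fix P assume "eventually P (unif S)"
    then obtain D where D: "D \<in> entourages S" "\<forall>p\<in>D. P p"
      using entourage_within[OF S] by blast
    have "P (map_prod endpoint endpoint (c, d))" if "(c, d) \<in> star_entourage S E (D \<inter> E)" for c d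
      using that D(2) unfolding star_entourage_def by (auto simp: endpoint_chain_class)
    then show "eventually (\<lambda>x. P (map_prod endpoint endpoint x)) (unif ?C)"
      unfolding eventually_unif_chain_space[OF E]
      by (intro bexI[of _ "D \<inter> E"]) (auto intro: entourages_Int D E)
  qed
  moreover have "filterlim (map_prod (inv_into (points ?C) endpoint) (inv_into (points ?C) endpoint))
      (unif ?C) (unif S)"
    unfolding filterlim_iff
  proof (intro allI impI)
    fix P assume "eventually P (unif ?C)"
    then obtain D where D: "D \<in> entourages S" "D \<subseteq> E" "\<And>p. p \<in> star_entourage S E D \<Longrightarrow> P p"
      unfolding eventually_unif_chain_space[OF E] by blast
    have "P (inv_into (points ?C) endpoint y, inv_into (points ?C) endpoint z)"
      if yz: "(y, z) \<in> D" for y z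
    proof -
      have pt: "y \<in> points S" "z \<in> points S"
        using entourages_points[OF D(1) yz] by auto
      then obtain \<alpha> where \<alpha>: "is_chain S E (basepoint S) y \<alpha>"
        using sc by (auto simp: simply_chained_def)
      have "is_chain S E (basepoint S) z (\<alpha> @ [z])"
        using is_chain_snoc[OF \<alpha>] yz D(2) pt by blast
      then show ?thesis
        using D(3) star_entourage_iff[OF S E D(1,2) \<alpha>] yz inv \<alpha> by metis
    qed
    moreover have "eventually (\<lambda>p. p \<in> D) (unif S)"
      using D(1) by (simp add: entourages_def)
    ultimately show "eventually (\<lambda>x. P (map_prod (inv_into (points ?C) endpoint)
        (inv_into (points ?C) endpoint) x)) (unif S)"
      by (auto elim!: eventually_mono)
  qed
  ultimately show ?thesis
    using bij bij_betw_imp_funcset[OF bij] bij_betw_imp_funcset[OF bij_betw_inv_into[OF bij]]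
    unfolding unif_homeomorphism_def unif_continuous_def by blast
qed

section \<open>The chain space is simply chained\<close>

text \<open>With \<open>us = []\<close> this is the lift of a chain to \<open>X_E\<close>. The prefix \<open>us\<close> of the points
  already passed is a parameter so that lifts of concatenations split.\<close>

fun lift_chain ::
    "('a, 'm) pointed_space_scheme \<Rightarrow> ('a \<times> 'a) set \<Rightarrow> 'a list \<Rightarrow> 'a list \<Rightarrow> 'a list set list" where
  "lift_chain S E us [] = []"
| "lift_chain S E us (x # xs) = chain_class S E (us @ [x]) # lift_chain S E (us @ [x]) xs"

lemma lift_chain_append:
  "lift_chain S E us (xs @ ys) = lift_chain S E us xs @ lift_chain S E (us @ xs) ys"
  by (induction xs arbitrary: us) auto

lemma is_chain_lift_chain:
  assumes S: "pointed_uniform_space S" and E: "E \<in> entourages S"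
    and "is_chain S E (basepoint S) q \<alpha>"
  shows "is_chain (chain_space S E) (star_entourage S E E) (basepoint (chain_space S E))
    (chain_class S E \<alpha>) (lift_chain S E [] \<alpha>)"
  using assms(3)
proof (induction \<alpha> arbitrary: q rule: rev_induct)
  case Nil
  then show ?case by (simp add: is_chain_def)
next
  case (snoc x xs)
  show ?case
  proof (cases "xs = []")
    case True
    then have "x = basepoint S" using snoc.prems by (simp add: is_chain_def)
    then show ?thesis
      using True chain_class_in_points[OF snoc.prems] by (simp add: is_chain_def chain_space_def)
  next
    case False
    then have xs: "is_chain S E (basepoint S) (last xs) xs" "(last xs, x) \<in> E"
      using snoc.prems by (auto simp: is_chain_def successively_append_iff)
    then have "(chain_class S E xs, chain_class S E (xs @ [x])) \<in> star_entourage S E E"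
      using star_entourage_iff[OF S E E order_refl xs(1)] by blast
    then show ?thesis
      using is_chain_snoc[OF snoc.IH[OF xs(1)]] chain_class_in_points[OF snoc.prems]
      by (simp add: lift_chain_append)
  qed
qed

text \<open>An inserted point does not change the class of any longer prefix, because its insertion into
  that prefix is itself an elementary homotopy.\<close>

lemma lift_chain_insert:
  assumes "is_chain S E p q (xs @ ys)" "is_chain S E p q (xs @ x # ys)"
  shows "lift_chain S E (xs @ [x]) ys = lift_chain S E xs ys"
  using assms
proof (induction ys arbitrary: q rule: rev_induct)
  case Nil
  then show ?case by simp
next
  case (snoc y ys)
  have "chain_homotopic S E (xs @ ys @ [y]) (xs @ x # ys @ [y])"
    by (rule chain_homotopic_insert) (use snoc.prems in auto)
  then have last: "chain_class S E (xs @ ys @ [y]) = chain_class S E (xs @ x # ys @ [y])"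
    by (simp add: chain_class_eq_iff)
  have "lift_chain S E (xs @ [x]) ys = lift_chain S E xs ys"
  proof (cases "ys = []")
    case False
    show ?thesis
    proof (rule snoc.IH)
      show "is_chain S E p (last ys) (xs @ ys)" "is_chain S E p (last ys) (xs @ x # ys)"
        using snoc.prems False by (auto simp: is_chain_def successively_append_iff successively_Cons hd_append)
    qed
  qed simp
  then show ?case by (simp add: lift_chain_append last)
qed

text \<open>Homotopy lifting: the insertion of a point downstairs becomes the insertion of a single class
  upstairs.\<close>

lemma chain_homotopic_lift_chain:
  assumes S: "pointed_uniform_space S" and E: "E \<in> entourages S"
    and \<alpha>: "is_chain S E (basepoint S) q \<alpha>" and "chain_homotopic S E \<alpha> \<beta>"
  shows "chain_homotopic (chain_space S E) (star_entourage S E E)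
    (lift_chain S E [] \<alpha>) (lift_chain S E [] \<beta>)"
  using assms(4) \<alpha>
proof (rule chain_homotopic_image)
  fix a b assume ab: "adds_point S E a b" "is_chain S E (basepoint S) q a"
    "is_chain S E (basepoint S) q b"
  then obtain xs x ys where eq: "a = xs @ ys" "b = xs @ x # ys"
    by (auto simp: adds_point_def)
  have "chain_homotopic S E a b"
    using ab(1) by (auto simp: chain_homotopic_def)
  then have "chain_class S E a = chain_class S E b"
    by (simp add: chain_class_eq_iff)
  moreover have "lift_chain S E [] b
      = lift_chain S E [] xs @ chain_class S E (xs @ [x]) # lift_chain S E xs ys"
    using lift_chain_insert[of S E _ _ xs ys x] ab(2,3) eq by (simp add: lift_chain_append)
  moreover have "lift_chain S E [] a = lift_chain S E [] xs @ lift_chain S E xs ys"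
    by (simp add: eq lift_chain_append)
  ultimately show "chain_homotopic (chain_space S E) (star_entourage S E E)
      (lift_chain S E [] a) (lift_chain S E [] b)"
    using is_chain_lift_chain[OF S E ab(2)] is_chain_lift_chain[OF S E ab(3)]
    by (metis chain_homotopic_insert)
qed

text \<open>Unique path lifting: a step of \<open>E*\<close> extends every representative of its source by the
  endpoint of its target.\<close>

lemma lift_chain_endpoints:
  assumes S: "pointed_uniform_space S" and E: "E \<in> entourages S"
    and "is_chain (chain_space S E) (star_entourage S E E) (basepoint (chain_space S E)) c cs"
  shows "is_chain S E (basepoint S) (endpoint c) (map endpoint cs)
    \<and> lift_chain S E [] (map endpoint cs) = cs \<and> chain_class S E (map endpoint cs) = c"
  using assms(3)
proof (induction cs arbitrary: c rule: rev_induct)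
  case Nil
  then show ?case by (simp add: is_chain_def)
next
  case (snoc d cs)
  then have [simp]: "d = c" by (simp add: is_chain_def)
  show ?case
  proof (cases "cs = []")
    case True
    have pt: "is_chain S E (basepoint S) (basepoint S) [basepoint S]"
      using S by (simp add: is_chain_singleton pointed_uniform_space_def)
    have "c = chain_class S E [basepoint S]"
      using snoc.prems True by (simp add: is_chain_def chain_space_def)
    then show ?thesis
      using True pt endpoint_chain_class[OF pt] by simp
  next
    case False
    then have cs: "is_chain (chain_space S E) (star_entourage S E E) (basepoint (chain_space S E))
        (last cs) cs" and step: "(last cs, c) \<in> star_entourage S E E"
      using snoc.prems by (auto simp: is_chain_def successively_append_iff)
    let ?\<alpha> = "map endpoint cs"
    note IH = snoc.IH[OF cs]
    then have \<alpha>: "is_chain S E (basepoint S) (endpoint (last cs)) ?\<alpha>"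
      "chain_class S E ?\<alpha> = last cs" by auto
    then obtain z where z: "(endpoint (last cs), z) \<in> E" "c = chain_class S E (?\<alpha> @ [z])"
      using star_entourage_iff[OF S E E order_refl \<alpha>(1)] step by auto
    have ch: "is_chain S E (basepoint S) z (?\<alpha> @ [z])"
      using is_chain_snoc[OF \<alpha>(1) z(1)] entourages_points[OF E z(1)] by blast
    then have "endpoint c = z"
      using z(2) by (simp add: endpoint_chain_class)
    then show ?thesis
      using ch z(2) IH by (simp add: lift_chain_append)
  qed
qed

text \<open>Chains in \<open>X_E\<close> are determined by their projections to \<open>X\<close>, and homotopies of the
  projections lift.\<close>

lemma simply_chained_chain_space:
  assumes S: "pointed_uniform_space S" and E: "E \<in> entourages S"
  shows "simply_chained (chain_space S E) (star_entourage S E E)"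
  unfolding simply_chained_def
proof (intro conjI ballI allI impI)
  fix c assume "c \<in> points (chain_space S E)"
  then show "\<exists>cs. is_chain (chain_space S E) (star_entourage S E E)
      (basepoint (chain_space S E)) c cs"
    by (metis chain_space_pointE is_chain_lift_chain[OF S E])
next
  fix c cs ds
  assume "is_chain (chain_space S E) (star_entourage S E E) (basepoint (chain_space S E)) c cs"
    and "is_chain (chain_space S E) (star_entourage S E E) (basepoint (chain_space S E)) c ds"
  from this[THEN lift_chain_endpoints[OF S E]]
  show "chain_homotopic (chain_space S E) (star_entourage S E E) cs ds"
    using chain_homotopic_lift_chain[OF S E] by (metis chain_class_eq_iff)
qed

section \<open>Pulling back along a surjection\<close>

text \<open>Points of \<open>Y\<close> with the same image under \<open>f\<close> are within \<open>F\<close> of the same points, so each inner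
  point of a chain can be exchanged for another point of its fibre: insert the new point next to
  the old one, then remove the old one.\<close>

lemma chain_homotopic_change_inner:
  assumes refl: "\<And>z. z \<in> points Z \<Longrightarrow> (z, z) \<in> G"
    and f: "f \<in> points Y \<rightarrow> points Z"
    and F: "F = {(x, y) \<in> points Y \<times> points Y. (f x, f y) \<in> G}"
    and h: "\<And>y. y \<in> points Y \<Longrightarrow> h y \<in> points Y \<and> f (h y) = f y"
    and "us \<noteq> []" "ws \<noteq> []" "is_chain Y F p q (us @ ys @ ws)"
  shows "chain_homotopic Y F (us @ ys @ ws) (us @ map h ys @ ws)"
  using assms(5-)
proof (induction ys arbitrary: us)
  case Nil
  then show ?case by (simp add: chain_homotopic_refl)
next
  case (Cons y ys)
  have y: "y \<in> points Y" and hy: "h y \<in> points Y" "f (h y) = f y" "f y \<in> points Z"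
    using Cons.prems(3) h f by (auto simp: is_chain_def)
  have both: "is_chain Y F p q (us @ y # h y # ys @ ws)"
    using Cons.prems y hy refl
    by (auto simp: is_chain_def successively_append_iff successively_Cons F hd_append)
  have new: "is_chain Y F p q (us @ h y # ys @ ws)"
    using Cons.prems y hy
    by (auto simp: is_chain_def successively_append_iff successively_Cons F hd_append)
  have "chain_homotopic Y F (us @ (y # ys) @ ws) ((us @ [y]) @ h y # ys @ ws)"
    using chain_homotopic_insert[of Y F p q "us @ [y]" "ys @ ws" "h y"] both Cons.prems(3) by simp
  also have "chain_homotopic Y F ((us @ [y]) @ h y # ys @ ws) (us @ h y # ys @ ws)"
    using chain_homotopic_insert[of Y F p q us "h y # ys @ ws" y] both new
    by (simp add: chain_homotopic_sym)
  also have "chain_homotopic Y F (us @ h y # ys @ ws) (us @ map h (y # ys) @ ws)"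
    using Cons.IH[of "us @ [h y]"] new Cons.prems(2) by simp
  finally show ?case .
qed

text \<open>Chains and homotopies lift along a section \<open>s\<close> of \<open>f\<close>. Framing a lifted chain with the
  prescribed end points keeps them fixed, because \<open>s (f p)\<close> need not be \<open>p\<close>.\<close>

lemma simply_chained_pullback:
  assumes sc: "simply_chained Z G"
    and refl: "\<And>z. z \<in> points Z \<Longrightarrow> (z, z) \<in> G"
    and f: "f ` points Y = points Z"
    and base: "basepoint Y \<in> points Y" "f (basepoint Y) = basepoint Z"
    and F: "F = {(x, y) \<in> points Y \<times> points Y. (f x, f y) \<in> G}"
  shows "simply_chained Y F"
proof -
  define s where "s = inv_into (points Y) f"
  have s: "s z \<in> points Y" "f (s z) = z" if "z \<in> points Z" for z
    using that f unfolding s_def by (auto simp: inv_into_into f_inv_into_f)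
  have fY: "f y \<in> points Z" if "y \<in> points Y" for y
    using that f by blast
  \<comment> \<open>The two extra steps at the ends stay in a single fibre, so reflexivity of \<open>G\<close> suffices for them.\<close>
  have framed: "is_chain Y F p q (p # map s zs @ [q])"
    if pq: "p \<in> points Y" "q \<in> points Y" and zs: "is_chain Z G (f p) (f q) zs" for p q zs
  proof -
    have ne: "zs \<noteq> []" and pt: "set zs \<subseteq> points Z" and ends: "hd zs = f p" "last zs = f q"
      and succ: "successively (\<lambda>x y. (x, y) \<in> G) zs"
      using zs by (auto simp: is_chain_def)
    have "successively (\<lambda>x y. (x, y) \<in> F) (map s zs)"
      unfolding successively_map using succ
      by (rule successively_mono) (use pt s in \<open>auto simp: F subset_iff\<close>)
    moreover have "(p, hd (map s zs)) \<in> F" "(last (map s zs), q) \<in> F"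
      using ne ends pq s fY refl by (auto simp: F hd_map last_map)
    ultimately show ?thesis
      using ne pt s pq
      by (auto simp: is_chain_def successively_append_iff successively_Cons hd_append)
  qed
  show ?thesis
    unfolding simply_chained_def
  proof (intro conjI ballI allI impI)
    fix q assume "q \<in> points Y"
    then show "\<exists>\<alpha>. is_chain Y F (basepoint Y) q \<alpha>"
      using framed[of "basepoint Y" q] sc fY base unfolding simply_chained_def by metis
  next
    fix q \<alpha> \<beta>
    assume \<alpha>: "is_chain Y F (basepoint Y) q \<alpha>" and \<beta>: "is_chain Y F (basepoint Y) q \<beta>"
    let ?p = "basepoint Y"
    define frame where "frame \<gamma> = ?p # map s \<gamma> @ [q]" for \<gamma>
    have q: "q \<in> points Y" using \<alpha> by (auto simp: is_chain_def)
    have proj: "is_chain Z G (f ?p) (f q) (map f \<gamma>)"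
      and norm: "chain_homotopic Y F \<gamma> (frame (map f \<gamma>))" if \<gamma>: "is_chain Y F ?p q \<gamma>" for \<gamma>
    proof -
      have "successively (\<lambda>x y. (f x, f y) \<in> G) \<gamma>"
        using \<gamma> by (auto simp: is_chain_def F elim: successively_mono)
      then show "is_chain Z G (f ?p) (f q) (map f \<gamma>)"
        using \<gamma> fY by (auto simp: is_chain_def successively_map hd_map last_map)
      have pq: "(?p, ?p) \<in> F" "(q, q) \<in> F"
        using base(1) q fY refl by (auto simp: F)
      have 1: "is_chain Y F ?p q (?p # \<gamma>)"
        using \<gamma> pq base(1) by (auto simp: is_chain_def successively_Cons)
      have 2: "is_chain Y F ?p q ([?p] @ \<gamma> @ [q])"
        using is_chain_snoc[OF 1 pq(2) q] by simp
      \<comment> \<open>Doubling both end points turns all points of \<open>\<gamma>\<close> into inner points, so that every one of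
        them can be moved within its fibre.\<close>
      have "chain_homotopic Y F \<gamma> (?p # \<gamma>)"
        using chain_homotopic_insert[of Y F ?p q "[]" \<gamma> ?p] \<gamma> 1 by simp
      also have "chain_homotopic Y F (?p # \<gamma>) ([?p] @ \<gamma> @ [q])"
        using chain_homotopic_insert[of Y F ?p q "?p # \<gamma>" "[]" q] 1 2 by simp
      also have "chain_homotopic Y F ([?p] @ \<gamma> @ [q]) ([?p] @ map (s \<circ> f) \<gamma> @ [q])"
        by (rule chain_homotopic_change_inner[OF refl _ F _ _ _ 2]) (use fY s in auto)
      finally show "chain_homotopic Y F \<gamma> (frame (map f \<gamma>))"
        by (simp add: frame_def)
    qed
    have hom: "chain_homotopic Z G (map f \<alpha>) (map f \<beta>)"
      using sc proj[OF \<alpha>] proj[OF \<beta>] base(2) unfolding simply_chained_def by metis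
    have "chain_homotopic Y F (frame (map f \<alpha>)) (frame (map f \<beta>))"
      using hom proj[OF \<alpha>]
    proof (rule chain_homotopic_image)
      fix a b assume ab: "adds_point Z G a b" "is_chain Z G (f ?p) (f q) a"
        "is_chain Z G (f ?p) (f q) b"
      then obtain xs x ys where eq: "a = xs @ ys" "b = xs @ x # ys"
        by (auto simp: adds_point_def)
      then show "chain_homotopic Y F (frame a) (frame b)"
        using chain_homotopic_insert[of Y F ?p q "?p # map s xs" "map s ys @ [q]" "s x"]
          framed[OF base(1) q ab(2)] framed[OF base(1) q ab(3)]
        by (simp add: frame_def)
    qed
    then show "chain_homotopic Y F \<alpha> \<beta>"
      using norm[OF \<alpha>] norm[OF \<beta>] chain_homotopic_sym chain_homotopic_trans by meson
  qed
qed

section \<open>The uniformity of the inverse limit\<close>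

definition limit_entourage ::
    "('a, 'm) pointed_space_scheme \<Rightarrow> ('a \<times> 'a) set
      \<Rightarrow> ((('a \<times> 'a) set \<Rightarrow> 'a list set) \<times> (('a \<times> 'a) set \<Rightarrow> 'a list set)) set" where
  "limit_entourage S E = {(x, y) \<in> points (inverse_limit S) \<times> points (inverse_limit S).
     (x E, y E) \<in> star_entourage S E E}"

lemma inverse_limit_point:
  assumes "x \<in> points (inverse_limit S)"
  shows "E \<in> entourages S \<Longrightarrow> x E \<in> points (chain_space S E)"
    and "D \<in> entourages S \<Longrightarrow> E \<in> entourages S \<Longrightarrow> D \<subseteq> E \<Longrightarrow> coarsen S E (x D) = x E"
  using assms by (auto simp: inverse_limit_def Let_def)

lemma limit_entourage_coarsen:
  assumes "D \<in> entourages S" "E \<in> entourages S" "D \<subseteq> E" "(x, y) \<in> limit_entourage S D"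
  shows "(x E, y E) \<in> star_entourage S E D"
proof -
  have x: "x \<in> points (inverse_limit S)" and y: "y \<in> points (inverse_limit S)"
    and xy: "(x D, y D) \<in> star_entourage S D D"
    using assms(4) by (auto simp: limit_entourage_def)
  show ?thesis
    using star_entourage_coarsen[OF xy assms(3)]
    by (simp only: inverse_limit_point(2)[OF x assms(1-3)] inverse_limit_point(2)[OF y assms(1-3)])
qed

lemma limit_entourage_mono:
  assumes "D \<in> entourages S" "E \<in> entourages S" "D \<subseteq> E"
  shows "limit_entourage S D \<subseteq> limit_entourage S E"
  using limit_entourage_coarsen[OF assms] star_entourage_mono[OF assms(3), of S E]
  by (auto simp: limit_entourage_def)

text \<open>Every \<open>D*\<close> on \<open>X_E\<close> may be replaced by \<open>D*\<close> on \<open>X_D\<close>, whose preimage in the limit is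
  smaller; hence one preimage for each entourage suffices to generate the uniformity.\<close>

lemma eventually_unif_inverse_limit:
  assumes S: "pointed_uniform_space S"
  shows "eventually P (unif (inverse_limit S)) \<longleftrightarrow>
    (\<exists>E\<in>entourages S. \<forall>p\<in>limit_entourage S E. P p)"
proof
  let ?L = "points (inverse_limit S)"
  let ?U = "INF E\<in>entourages S. principal (limit_entourage S E)"
  have unif: "unif (inverse_limit S) = inf (principal (?L \<times> ?L))
      (INF E\<in>entourages S. filtercomap (map_prod (\<lambda>x. x E) (\<lambda>x. x E)) (unif (chain_space S E)))"
    by (simp add: inverse_limit_def Let_def)
  have ne: "entourages S \<noteq> {}" using entourages_UNIV[OF S] by blast
  have ev: "eventually P ?U \<longleftrightarrow> (\<exists>E\<in>entourages S. eventually P (principal (limit_entourage S E)))" for P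
  proof (rule eventually_INF_base[OF ne])
    fix D E assume DE: "D \<in> entourages S" "E \<in> entourages S"
    note DE' = entourages_Int[OF DE]
    show "\<exists>F\<in>entourages S. principal (limit_entourage S F)
        \<le> inf (principal (limit_entourage S D)) (principal (limit_entourage S E))"
      using DE' limit_entourage_mono[OF DE' DE(1)] limit_entourage_mono[OF DE' DE(2)]
      by (intro bexI[of _ "D \<inter> E"]) auto
  qed
  {
    assume "eventually P (unif (inverse_limit S))"
    moreover have "?U \<le> unif (inverse_limit S)"
      unfolding unif
    proof (intro le_infI INF_greatest)
      obtain E where "E \<in> entourages S" using ne by blast
      then show "?U \<le> principal (?L \<times> ?L)"
        by (rule INF_lower2) (auto simp: limit_entourage_def)
    next
      fix E assume E: "E \<in> entourages S"
      show "?U \<le> filtercomap (map_prod (\<lambda>x. x E) (\<lambda>x. x E)) (unif (chain_space S E))"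
      proof (rule filter_leI)
        fix P assume "eventually P (filtercomap (map_prod (\<lambda>x. x E) (\<lambda>x. x E)) (unif (chain_space S E)))"
        then obtain Q where Q: "eventually Q (unif (chain_space S E))" "\<And>x y. Q (x E, y E) \<Longrightarrow> P (x, y)"
          by (auto simp: eventually_filtercomap)
        then obtain D where D: "D \<in> entourages S" "D \<subseteq> E" "\<forall>c\<in>star_entourage S E D. Q c"
          unfolding eventually_unif_chain_space[OF E] by blast
        then have "\<forall>p\<in>limit_entourage S D. P p"
          using limit_entourage_coarsen[OF D(1) E D(2)] Q(2) by auto
        then show "eventually P ?U"
          using D(1) unfolding ev by (auto simp: eventually_principal)
      qed
    qed
    ultimately have "eventually P ?U" by (simp add: filter_leD)
    then show "\<exists>E\<in>entourages S. \<forall>p\<in>limit_entourage S E. P p"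
      unfolding ev by (simp add: eventually_principal)
  next
    assume "\<exists>E\<in>entourages S. \<forall>p\<in>limit_entourage S E. P p"
    then obtain E where E: "E \<in> entourages S" "\<And>p. p \<in> limit_entourage S E \<Longrightarrow> P p" by blast
    have "eventually (\<lambda>p. p \<in> star_entourage S E E) (unif (chain_space S E))"
      unfolding eventually_unif_chain_space[OF E(1)] using E(1) by blast
    then have "eventually (\<lambda>(x, y). (x E, y E) \<in> star_entourage S E E)
        (filtercomap (map_prod (\<lambda>x. x E) (\<lambda>x. x E)) (unif (chain_space S E)))"
      by (rule eventually_filtercomapI[THEN eventually_mono]) auto
    then have "eventually (\<lambda>(x, y). (x E, y E) \<in> star_entourage S E E) (unif (inverse_limit S))"
      unfolding unif by (rule filter_leD[rotated]) (intro le_infI2 INF_lower E)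
    moreover have "eventually (\<lambda>p. p \<in> ?L \<times> ?L) (unif (inverse_limit S))"
      unfolding unif by (rule filter_leD[OF inf_le1]) (simp add: eventually_principal)
    ultimately show "eventually P (unif (inverse_limit S))"
      by eventually_elim (auto intro!: E(2) simp: limit_entourage_def)
  }
qed

lemma sym_limit_entourage:
  assumes "E \<in> entourages S"
  shows "sym (limit_entourage S E)"
  using sym_star_entourage[of E S E] assms
  by (auto simp: limit_entourage_def entourages_def intro!: symI dest: symD)

lemma basepoint_inverse_limit:
  assumes S: "pointed_uniform_space S"
  shows "basepoint (inverse_limit S) \<in> points (inverse_limit S)"
    and "E \<in> entourages S \<Longrightarrow> basepoint (inverse_limit S) E = basepoint (chain_space S E)"
proof -
  have base: "is_chain S E (basepoint S) (basepoint S) [basepoint S]" for E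
    using S by (simp add: is_chain_singleton pointed_uniform_space_def)
  have "basepoint (chain_space S E) \<in> points (chain_space S E)" for E
    using chain_class_in_points[OF base] by (simp add: chain_space_def)
  then show "basepoint (inverse_limit S) \<in> points (inverse_limit S)"
    by (auto simp: inverse_limit_def Let_def)
      (simp_all add: chain_space_def coarsen_chain_class)
  show "E \<in> entourages S \<Longrightarrow> basepoint (inverse_limit S) E = basepoint (chain_space S E)"
    by (simp add: inverse_limit_def Let_def)
qed

lemma pointed_uniform_space_inverse_limit:
  assumes S: "pointed_uniform_space S"
  shows "pointed_uniform_space (inverse_limit S)"
  unfolding pointed_uniform_space_def
proof (intro conjI allI impI)
  let ?L = "inverse_limit S"
  note ev = eventually_unif_inverse_limit[OF S]
  show "basepoint ?L \<in> points ?L" by (rule basepoint_inverse_limit(1)[OF S])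
  show "unif ?L \<le> principal (points ?L \<times> points ?L)"
    unfolding le_principal ev using entourages_UNIV[OF S] by (auto simp: limit_entourage_def)
  fix P assume "eventually P (unif ?L)"
  then obtain E where E: "E \<in> entourages S" "\<And>p. p \<in> limit_entourage S E \<Longrightarrow> P p"
    unfolding ev by blast
  show "\<forall>x\<in>points ?L. P (x, x)"
    using E(2) star_entourage_refl[OF S E(1)] inverse_limit_point(1)[OF _ E(1)]
    by (auto simp: limit_entourage_def)
  show "eventually (\<lambda>(x, y). P (y, x)) (unif ?L)"
    unfolding ev using E sym_limit_entourage[OF E(1)] by (auto dest: symD)
  obtain D where D: "D \<in> entourages S" "D \<subseteq> E"
      "\<And>x y z. (x, y) \<in> D \<Longrightarrow> (y, z) \<in> D \<Longrightarrow> (x, z) \<in> E"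
    using entourages_half[OF S E(1)] by blast
  have "(x, z) \<in> limit_entourage S E"
    if "(x, y) \<in> limit_entourage S D" "(y, z) \<in> limit_entourage S D" for x y z
  proof -
    have "(x E, z E) \<in> star_entourage S E E"
      by (rule star_entourage_trans[OF S E(1) D(1,2)])
        (use D(3) that limit_entourage_coarsen[OF D(1) E(1) D(2)] in blast)+
    then show ?thesis
      using that by (auto simp: limit_entourage_def)
  qed
  then show "\<exists>Q. eventually Q (unif ?L) \<and> (\<forall>x y z. Q (x, y) \<longrightarrow> Q (y, z) \<longrightarrow> P (x, z))"
    using D(1) E(2) unfolding ev
    by (intro exI[of _ "\<lambda>p. p \<in> limit_entourage S D"]) blast
qed

lemma limit_entourage_in_entourages:
  assumes S: "pointed_uniform_space S" and E: "E \<in> entourages S"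
  shows "limit_entourage S E \<in> entourages (inverse_limit S)"
  using sym_limit_entourage[OF E] E
  by (auto simp: entourages_def eventually_unif_inverse_limit[OF S] limit_entourage_def)

lemma uniformity_base_limit_entourages:
  assumes S: "pointed_uniform_space S" and B: "uniformity_base S B"
  shows "uniformity_base (inverse_limit S) (limit_entourage S ` B)"
proof -
  have BE: "E \<in> entourages S" if "E \<in> B" for E
    using B that by (auto simp: uniformity_base_def)
  have "\<exists>E\<in>B. limit_entourage S E \<subseteq> V" if V: "V \<in> entourages (inverse_limit S)" for V
  proof -
    obtain D where D: "D \<in> entourages S" "\<forall>p\<in>limit_entourage S D. p \<in> V"
      using V eventually_unif_inverse_limit[OF S] by (auto simp: entourages_def)
    then obtain E where "E \<in> B" "E \<subseteq> D"
      using B by (auto simp: uniformity_base_def)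
    then show ?thesis
      using limit_entourage_mono[OF BE D(1)] D(2) by blast
  qed
  then show ?thesis
    using limit_entourage_in_entourages[OF S BE] by (auto simp: uniformity_base_def)
qed

section \<open>Universality\<close>

theorem theorem49:
  fixes X :: "'a pointed_space"
  assumes "coverable X"
  shows "universal (inverse_limit X)"
proof -
  obtain B where X: "pointed_uniform_space X" and B: "uniformity_base X B"
    and surj: "\<And>E. E \<in> B \<Longrightarrow> (\<lambda>x. x E) ` points (inverse_limit X) = points (chain_space X E)"
    using assms by (auto simp: coverable_def)
  have "unif_homeomorphism (chain_space (inverse_limit X) (limit_entourage X E))
      (inverse_limit X) endpoint" if EB: "E \<in> B" for E
  proof -
    have E: "E \<in> entourages X" using B EB by (auto simp: uniformity_base_def)
    have "simply_chained (inverse_limit X) (limit_entourage X E)"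
    proof (rule simply_chained_pullback)
      show "simply_chained (chain_space X E) (star_entourage X E E)"
        by (rule simply_chained_chain_space[OF X E])
      show "(c, c) \<in> star_entourage X E E" if "c \<in> points (chain_space X E)" for c
        using star_entourage_refl[OF X E that] .
      show "(\<lambda>x. x E) ` points (inverse_limit X) = points (chain_space X E)"
        by (rule surj[OF EB])
    qed (simp_all add: basepoint_inverse_limit[OF X] E limit_entourage_def)
    then show ?thesis
      by (intro unif_homeomorphism_endpoint pointed_uniform_space_inverse_limit
          limit_entourage_in_entourages X E)
  qed
  then show ?thesis
    unfolding universal_def
    using pointed_uniform_space_inverse_limit[OF X] uniformity_base_limit_entourages[OF X B]
    by blast
qed

end
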